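(* Let $\mathbf{A}\in\mathbb{R}^{m\times n}$ have full column rank and no zero rows, let $p>2$, and let $\overline{\mathbf{w}}\in\mathbb{R}^m_{>0}$ denote its $\ell_p$-Lewis weights. Then for every $i\in[m]$ we have $\overline{w}_i\le s_i^{(p)}(\mathbf{A})$, where $s_i^{(p)}(\mathbf{A})$ is the $\ell_p$ sensitivity of the $i$-th row; combined with the known bound $s_i^{(p)}(\mathbf{A})\le n^{p/2-1}\overline{w}_i$, this gives $$\overline{w}_i\le s_i^{(p)}(\mathbf{A})\le n^{p/2-1}\,\overline{w}_i\qquad\text{for every } i\in[m].$$ Consequently, if $\varepsilon\in(0,1)$ and $\widehat{\mathbf{w}}\in\mathbb{R}^m$ satisfies $(1-\varepsilon)\overline{w}_i\le\widehat{w}_i\le(1+\varepsilon)\overline{w}_i$ for every $i\in[m]$, then simultaneously for every $i\in[m]$, $$\frac{\widehat{w}_i}{1+\varepsilon}\le s_i^{(p)}(\mathbf{A})\le\frac{n^{p/2-1}\,\widehat{w}_i}{1-\varepsilon}.$$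
   Context: Let $\mathbf{a}_i^\top$ be the $i$-th row of $\mathbf{A}$. The $\ell_p$ sensitivity of the $i$-th row is $s_i^{(p)}(\mathbf{A}):=\sup_{\mathbf{x}\ne\mathbf{0}}\frac{|\mathbf{a}_i^\top\mathbf{x}|^p}{\|\mathbf{A}\mathbf{x}\|_p^p}$. For a full-column-rank matrix $\mathbf{B}$ with rows $\mathbf{b}_i^\top$, the $i$-th leverage score is $\sigma_i(\mathbf{B}):=\mathbf{b}_i^\top(\mathbf{B}^\top\mathbf{B})^{-1}\mathbf{b}_i$. The $\ell_p$-Lewis weights of $\mathbf{A}$ are the unique vector $\overline{\mathbf{w}}\in\mathbb{R}^m_{>0}$ satisfying $\overline{w}_i=\sigma_i(\overline{\mathbf{W}}^{1/2-1/p}\mathbf{A})$ for all $i\in[m]$, where $\overline{\mathbf{W}}=\operatorname{Diag}(\overline{\mathbf{w}})$ (existence and uniqueness are known). *)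

theory Defs
  imports "HOL-Analysis.Analysis"
begin

definition diag_matrix :: "real ^ 'm \<Rightarrow> real ^ 'm ^ 'm" where
  "diag_matrix v = (\<chi> i j. if i = j then v $ i else 0)"

definition lp_norm :: "real \<Rightarrow> real ^ 'm \<Rightarrow> real" where
  "lp_norm p y = (\<Sum>i\<in>UNIV. \<bar>y $ i\<bar> powr p) powr (1 / p)"

text \<open>
  The supremum is taken in the reals. For \<open>A\<close> of full column rank and \<open>p > 0\<close> every
  denominator is positive and every quotient lies in \<open>[0, 1]\<close>, so it is the supremum of a
  nonempty bounded set.
\<close>
definition lp_sensitivity :: "real \<Rightarrow> real ^ 'n ^ 'm \<Rightarrow> 'm \<Rightarrow> real" where
  "lp_sensitivity p A i =
     (SUP x\<in>{x. x \<noteq> 0}. \<bar>row i A \<bullet> x\<bar> powr p / lp_norm p (A *v x) powr p)"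

text \<open>
  Meaningful for \<open>B\<close> of full column rank; otherwise \<open>transpose B ** B\<close> is singular
  and \<open>matrix_inv\<close> is unspecified.
\<close>
definition leverage_score :: "real ^ 'n ^ 'm \<Rightarrow> 'm \<Rightarrow> real" where
  "leverage_score B i = row i B \<bullet> (matrix_inv (transpose B ** B) *v row i B)"

text \<open>
  The vector \<open>w\<close> is the vector of \<open>\<ell>\<^sub>p\<close>-Lewis weights of \<open>A\<close>: for \<open>A\<close> of full column rank
  without zero rows exactly one \<open>w\<close> has this property. The power of the positive diagonal
  matrix \<open>diag_matrix w\<close> is taken entrywise on the diagonal.
\<close>
definition is_lewis_weights :: "real \<Rightarrow> real ^ 'n ^ 'm \<Rightarrow> real ^ 'm \<Rightarrow> bool" where
  "is_lewis_weights p A w \<longleftrightarrow>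
     (\<forall>i. w $ i > 0) \<and>
     (\<forall>i. w $ i = leverage_score (diag_matrix (\<chi> j. (w $ j) powr (1/2 - 1/p)) ** A) i)"

end

theory Submission
  imports Defs
begin

text \<open>
  Let \<open>a\<^sub>i\<close> be the rows of \<open>A\<close>, \<open>B\<close> the matrix with rows \<open>w\<^sub>i powr (1/2 - 1/p) *\<^sub>R a\<^sub>i\<close> and
  \<open>G = B\<^sup>T B\<close>. The Lewis condition says
  \<open>a\<^sub>i \<bullet> G\<^sup>-\<^sup>1 a\<^sub>i = w\<^sub>i powr (2/p)\<close>, so by Cauchy--Schwarz \<open>\<bar>a\<^sub>j \<bullet> G\<^sup>-\<^sup>1 a\<^sub>i\<bar> \<le> (w\<^sub>i w\<^sub>j) powr (1/p)\<close>.

  Lower bound: test the sensitivity with \<open>y = G\<^sup>-\<^sup>1 a\<^sub>i\<close>. The numerator is \<open>w\<^sub>i\<^sup>2\<close>, and splitting off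
  \<open>p - 2\<close> of the \<open>p\<close> factors \<open>\<bar>a\<^sub>j \<bullet> y\<bar>\<close> bounds the denominator by
  \<open>w\<^sub>i powr (1 - 2/p) * (\<Sum>j. w\<^sub>j powr (1 - 2/p) * (a\<^sub>j \<bullet> y)\<^sup>2) = w\<^sub>i powr (1 - 2/p) * (y \<bullet> G y) = w\<^sub>i\<close>.

  Upper bound: \<open>(a\<^sub>i \<bullet> x)\<^sup>2 \<le> w\<^sub>i powr (2/p) * \<parallel>B x\<parallel>\<^sup>2\<close>, and since \<open>\<Sum>j. w\<^sub>j = n\<close> (a trace), Jensen's
  inequality for \<open>t powr (p/2)\<close> with weights \<open>w\<^sub>j / n\<close> compares \<open>\<parallel>B x\<parallel>\<close> with the \<open>p\<close>-norm of \<open>A x\<close>.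
\<close>

section \<open>Jensen's inequality for powers\<close>

lemma convex_on_powr_atLeast:
  fixes q :: real
  assumes "q \<ge> 1"
  shows "convex_on {0..} (\<lambda>x. x powr q)"
proof (rule convex_on_linorderI)
  fix t x y :: real
  assume t: "0 < t" "t < 1" and xy: "x \<in> {0..}" "y \<in> {0..}" "x < y"
  show "((1 - t) *\<^sub>R x + t *\<^sub>R y) powr q \<le> (1 - t) * x powr q + t * y powr q"
  proof (cases "x = 0")
    \<comment> \<open>The endpoint 0 must be covered because Jensen is later applied to squared
      inner products, which can vanish. Here the claim reduces to
      \<open>t powr q \<le> t\<close>.\<close>
    case True
    have "t powr q \<le> t powr 1"
      using t assms by (intro powr_mono') auto
    then have "t powr q * y powr q \<le> t * y powr q"
      using t by (intro mult_right_mono) auto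
    then show ?thesis
      using True t xy assms by (simp add: powr_mult)
  next
    case False
    then show ?thesis
      using convex_onD[OF powr_convex[OF assms], of t x y] t xy by auto
  qed
qed simp

lemma sum_powr_jensen:
  fixes w u :: "'a::finite \<Rightarrow> real" and q :: real
  assumes q: "q \<ge> 1" and w: "\<And>j. w j > 0" and u: "\<And>j. u j \<ge> 0"
  shows "(\<Sum>j\<in>UNIV. w j * u j) powr q \<le> (\<Sum>j\<in>UNIV. w j) powr (q - 1) * (\<Sum>j\<in>UNIV. w j * u j powr q)"
proof -
  define T where "T = (\<Sum>j\<in>UNIV. w j)"
  have T: "T > 0" unfolding T_def by (intro sum_pos) (auto simp: w)
  \<comment> \<open>The weights \<open>w j / T\<close> sum to 1. Undoing the normalisation
    multiplies by \<open>T powr q / T\<close>, which is the factor \<open>T powr (q - 1)\<close> of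
    the claim.\<close>
  have "(\<Sum>j\<in>UNIV. (w j / T) *\<^sub>R u j) powr q \<le> (\<Sum>j\<in>UNIV. (w j / T) * (u j) powr q)"
    using T u w
    by (intro convex_on_sum[OF _ _ convex_on_powr_atLeast[OF q]])
       (auto simp: less_imp_le T_def simp flip: sum_divide_distrib)
  then have le: "((\<Sum>j\<in>UNIV. w j * u j) / T) powr q \<le> (\<Sum>j\<in>UNIV. w j * u j powr q) / T"
    by (simp add: sum_divide_distrib)
  have "(\<Sum>j\<in>UNIV. w j * u j) \<ge> 0"
    by (intro sum_nonneg mult_nonneg_nonneg) (auto simp: u w less_imp_le)
  then have "(\<Sum>j\<in>UNIV. w j * u j) powr q = T powr q * ((\<Sum>j\<in>UNIV. w j * u j) / T) powr q"
    using T by (simp add: powr_divide)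
  also have "\<dots> \<le> T powr q * ((\<Sum>j\<in>UNIV. w j * u j powr q) / T)"
    using le by (intro mult_left_mono) auto
  also have "\<dots> = T powr (q - 1) * (\<Sum>j\<in>UNIV. w j * u j powr q)"
    using T by (simp add: powr_diff)
  finally show ?thesis unfolding T_def .
qed

section \<open>Gram matrices and leverage scores\<close>

lemma matrix_vector_mul_row: "(A *v x) $ i = row i A \<bullet> x"
  for A :: "real ^ 'n ^ 'm"
  by (simp add: matrix_vector_mul_component row_def vec_nth_inverse)

lemma inner_gram: "((transpose B ** B) *v x) \<bullet> y = (B *v x) \<bullet> (B *v y)"
  for B :: "real ^ 'n ^ 'm"
  by (simp add: dot_lmul_matrix flip: matrix_vector_mul_assoc)

text \<open>A kernel vector \<open>x\<close> of the Gram matrix satisfies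
  \<open>(B *v x) \<bullet> (B *v x) = 0\<close>, so it lies in the kernel of
  \<open>B\<close>.\<close>

lemma invertible_gram:
  fixes B :: "real ^ 'n ^ 'm"
  assumes "inj ((*v) B)"
  shows "invertible (transpose B ** B)"
proof -
  have "x = 0" if "(transpose B ** B) *v x = 0" for x
  proof -
    have "(B *v x) \<bullet> (B *v x) = 0"
      using that by (simp flip: inner_gram)
    then have "B *v x = B *v 0" by simp
    then show ?thesis using assms by (meson injD)
  qed
  then show ?thesis
    by (simp add: invertible_left_inverse matrix_left_invertible_ker)
qed

lemma matrix_inv_inverse:
  fixes M :: "real ^ 'n ^ 'n"
  assumes "invertible M"
  shows "M ** matrix_inv M = mat 1" "matrix_inv M ** M = mat 1"
  using someI_ex[OF assms[unfolded invertible_def]] unfolding matrix_inv_def by auto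

text \<open>Leverage scores are the diagonal entries of the orthogonal projection onto the column
  space of \<open>B\<close>. Cyclicity of the trace turns their sum into the trace of the identity
  in dimension \<open>CARD('n)\<close>.\<close>

lemma sum_leverage_score:
  fixes B :: "real ^ 'n ^ 'm"
  assumes "inj ((*v) B)"
  shows "(\<Sum>i\<in>UNIV. leverage_score B i) = real CARD('n)"
proof -
  define N where "N = matrix_inv (transpose B ** B)"
  have "leverage_score B i = (B ** (N ** transpose B)) $ i $ i" for i
    by (simp add: leverage_score_def N_def matrix_matrix_mult_def matrix_vector_mult_def
        inner_vec_def row_def transpose_def)
  then have "(\<Sum>i\<in>UNIV. leverage_score B i) = trace (B ** (N ** transpose B))"
    by (simp add: trace_def)
  also have "\<dots> = trace ((N ** transpose B) ** B)"
    by (rule trace_mul_sym)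
  also have "\<dots> = trace (mat 1 :: real ^ 'n ^ 'n)"
    using matrix_inv_inverse(2)[OF invertible_gram[OF assms]]
    by (simp add: N_def flip: matrix_mul_assoc)
  finally show ?thesis by (simp add: trace_I)
qed

lemma row_diag_matrix_mult: "row i (diag_matrix d ** A) = d $ i *\<^sub>R row i A"
  for A :: "real ^ 'n ^ 'm"
  by (simp add: vec_eq_iff row_def diag_matrix_def matrix_matrix_mult_def if_distrib[of "\<lambda>x. x * _"]
      cong: if_cong)

lemma inj_diag_matrix_mult:
  fixes A :: "real ^ 'n ^ 'm"
  assumes "inj ((*v) A)" and "\<And>i. d $ i \<noteq> 0"
  shows "inj ((*v) (diag_matrix d ** A))"
proof (rule injI)
  fix x y
  assume eq: "(diag_matrix d ** A) *v x = (diag_matrix d ** A) *v y"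
  have "(A *v x) $ i = (A *v y) $ i" for i
    using arg_cong[OF eq, of "\<lambda>v. v $ i"] assms(2)[of i]
    by (simp add: matrix_vector_mul_row row_diag_matrix_mult)
  then have "A *v x = A *v y"
    by (simp only: vec_eq_iff) simp
  then show "x = y"
    by (rule injD[OF assms(1)])
qed

section \<open>Bounding the sensitivity from both sides\<close>

lemma lp_norm_powr:
  assumes "p > 0"
  shows "lp_norm p y powr p = (\<Sum>i\<in>UNIV. \<bar>y $ i\<bar> powr p)"
  using assms by (simp add: lp_norm_def powr_powr sum_nonneg)

lemma lp_sensitivity_le:
  fixes A :: "real ^ 'n ^ 'm"
  assumes "\<And>x. \<bar>row i A \<bullet> x\<bar> powr p \<le> C * lp_norm p (A *v x) powr p" and "C \<ge> 0"
  shows "lp_sensitivity p A i \<le> C"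
  unfolding lp_sensitivity_def
proof (rule cSUP_least)
  show "{x :: real ^ 'n. x \<noteq> 0} \<noteq> {}"
    using axis_eq_0_iff[of _ "1::real"] by blast
  show "\<bar>row i A \<bullet> x\<bar> powr p / lp_norm p (A *v x) powr p \<le> C" for x
  \<comment> \<open>Division by zero yields 0, so a vanishing denominator is handled by
    \<open>C \<ge> 0\<close>.\<close>
  proof (cases "lp_norm p (A *v x) = 0")
    case False
    then show ?thesis using assms(1)[of x] by (simp add: divide_le_eq)
  qed (simp add: assms)
qed

text \<open>The numerator is one summand of the denominator, so the quotients are bounded by 1 and
  the real supremum dominates each of them.\<close>

lemma quotient_le_lp_sensitivity:
  fixes A :: "real ^ 'n ^ 'm"
  assumes "p > 0" "x \<noteq> 0"
  shows "\<bar>row i A \<bullet> x\<bar> powr p / lp_norm p (A *v x) powr p \<le> lp_sensitivity p A i"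
  unfolding lp_sensitivity_def
proof (rule cSUP_upper)
  have "\<bar>row i A \<bullet> x\<bar> powr p / lp_norm p (A *v x) powr p \<le> 1" for x
  proof -
    have "\<bar>(A *v x) $ i\<bar> powr p \<le> (\<Sum>j\<in>UNIV. \<bar>(A *v x) $ j\<bar> powr p)"
      by (rule member_le_sum) auto
    then have "\<bar>row i A \<bullet> x\<bar> powr p \<le> lp_norm p (A *v x) powr p"
      using assms by (simp only: lp_norm_powr matrix_vector_mul_row)
    then show ?thesis
      by (intro divide_le_eq_1[THEN iffD2]) (smt (verit) powr_ge_zero)
  qed
  then show "bdd_above ((\<lambda>x. \<bar>row i A \<bullet> x\<bar> powr p / lp_norm p (A *v x) powr p) ` {x. x \<noteq> 0})"
    by (intro bdd_aboveI2)
qed (use assms in auto)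

section \<open>Geometry of the reweighted matrix\<close>

context
  fixes A B :: "real ^ 'n ^ 'm" and p :: real and w :: "real ^ 'm" and y :: "'m \<Rightarrow> real ^ 'n"
  assumes inj_A: "inj ((*v) A)"
    and p: "p > 2"
    and lewis: "is_lewis_weights p A w"
  defines "B \<equiv> diag_matrix (\<chi> j. (w $ j) powr (1/2 - 1/p)) ** A"
    and "y \<equiv> \<lambda>i. matrix_inv (transpose B ** B) *v row i A"
begin

lemma lewis_pos: "w $ i > 0"
  using lewis unfolding is_lewis_weights_def by blast

lemma inj_B: "inj ((*v) B)"
  unfolding B_def
proof (intro inj_diag_matrix_mult inj_A)
  show "(\<chi> j. w $ j powr (1/2 - 1/p)) $ i \<noteq> 0" for i
    using lewis_pos[of i] by simp
qed

lemma lewis_eq: "w $ i = leverage_score B i"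
  using lewis unfolding is_lewis_weights_def B_def by blast

lemma sum_lewis: "(\<Sum>i\<in>UNIV. w $ i) = real CARD('n)"
  using sum_leverage_score[OF inj_B] by (simp only: lewis_eq)

text \<open>Row \<open>i\<close> of \<open>B\<close> carries the factor
  \<open>w $ i powr (1/2 - 1/p)\<close> and enters the leverage score twice. Cancelling the
  resulting \<open>w $ i powr (1 - 2/p)\<close> from the Lewis equation leaves
  \<open>w $ i powr (2/p)\<close>.\<close>

lemma row_inner_y: "row i A \<bullet> y i = w $ i powr (2/p)"
proof -
  define d where "d = w $ i powr (1/2 - 1/p)"
  have "w $ i = d * d * (row i A \<bullet> y i)"
    by (subst lewis_eq) (simp add: leverage_score_def y_def B_def row_diag_matrix_mult d_def matrix_vector_mult_scaleR)
  moreover have "d * d = w $ i powr (1 - 2/p)"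
    by (simp add: d_def flip: powr_add)
  moreover have "w $ i = w $ i powr (1 - 2/p) * w $ i powr (2/p)"
    using lewis_pos[of i] by (simp flip: powr_add)
  ultimately have "w $ i powr (1 - 2/p) * (row i A \<bullet> y i) = w $ i powr (1 - 2/p) * w $ i powr (2/p)"
    by simp
  then show ?thesis
    using lewis_pos[of i] by simp
qed

text \<open>The vector \<open>y i\<close> represents the functional given by \<open>row i A\<close>
  in the inner product induced by the Gram matrix. This makes Cauchy-Schwarz available for the
  images under \<open>B\<close>.\<close>

lemma row_inner_eq: "row i A \<bullet> x = (B *v y i) \<bullet> (B *v x)"
proof -
  have "(transpose B ** B) *v y i = row i A"
    unfolding y_def matrix_vector_mul_assoc
    by (simp only: matrix_inv_inverse(1)[OF invertible_gram[OF inj_B]] matrix_vector_mul_lid)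
  then show ?thesis
    using inner_gram[of B "y i" x] by simp
qed

lemma norm_B_y: "(norm (B *v y i))\<^sup>2 = w $ i powr (2/p)"
  using row_inner_eq[of i "y i"] by (simp add: row_inner_y power2_norm_eq_inner)

lemma norm_B_sq: "(norm (B *v x))\<^sup>2 = (\<Sum>j\<in>UNIV. w $ j powr (1 - 2/p) * (row j A \<bullet> x)\<^sup>2)"
proof -
  have "(w $ j powr (1/2 - 1/p))\<^sup>2 = w $ j powr (1 - 2/p)" for j
    by (simp add: power2_eq_square flip: powr_add)
  moreover have "(B *v x) $ j = w $ j powr (1/2 - 1/p) * (row j A \<bullet> x)" for j
    by (simp add: matrix_vector_mul_row B_def row_diag_matrix_mult)
  ultimately show ?thesis
    by (simp add: power2_norm_eq_inner inner_vec_def power_mult_distrib flip: power2_eq_square)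
qed

lemma row_inner_sq_le: "(row i A \<bullet> x)\<^sup>2 \<le> w $ i powr (2/p) * (norm (B *v x))\<^sup>2"
  using Cauchy_Schwarz_ineq[of "B *v y i" "B *v x"]
  by (simp add: row_inner_eq norm_B_y flip: power2_norm_eq_inner)

lemma abs_powr_eq: "\<bar>t\<bar> powr p = (t\<^sup>2) powr (p/2)" for t :: real
proof -
  have "t\<^sup>2 = \<bar>t\<bar> powr 2" by (cases "t = 0") auto
  then show ?thesis by (simp only: powr_powr) simp
qed

section \<open>Lower bound on the sensitivity\<close>

lemma lp_norm_y_le: "lp_norm p (A *v y i) powr p \<le> w $ i"
proof -
  have exponent: "2 / p * (p/2 - 1) = 1 - 2/p"
    using p by (simp add: field_simps)
  have le: "\<bar>row j A \<bullet> y i\<bar> powr p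
      \<le> w $ i powr (1 - 2/p) * (w $ j powr (1 - 2/p) * (row j A \<bullet> y i)\<^sup>2)" for j
  proof -
    define t where "t = (row j A \<bullet> y i)\<^sup>2"
    have "t \<le> w $ j powr (2/p) * w $ i powr (2/p)"
      using row_inner_sq_le[of j "y i"] by (simp add: t_def norm_B_y)
    \<comment> \<open>One factor \<open>t\<close> is kept aside for the quadratic form. Only the
      remaining power is estimated, and its exponent is positive because
      \<open>p > 2\<close>.\<close>
    then have "t powr (p/2 - 1) \<le> (w $ j powr (2/p) * w $ i powr (2/p)) powr (p/2 - 1)"
      using p by (intro powr_mono2) (auto simp: t_def)
    also have "\<dots> = w $ j powr (1 - 2/p) * w $ i powr (1 - 2/p)"
      by (simp only: powr_mult powr_powr exponent)
    finally have "t * t powr (p/2 - 1) \<le> t * (w $ j powr (1 - 2/p) * w $ i powr (1 - 2/p))"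
      by (intro mult_left_mono) (auto simp: t_def)
    moreover have "t * t powr (p/2 - 1) = t powr (p/2)"
      by (subst powr_mult_base) (auto simp: t_def)
    ultimately show ?thesis
      by (simp add: abs_powr_eq t_def mult_ac)
  qed
  have "lp_norm p (A *v y i) powr p = (\<Sum>j\<in>UNIV. \<bar>row j A \<bullet> y i\<bar> powr p)"
    using p by (simp add: lp_norm_powr matrix_vector_mul_row)
  also have "\<dots> \<le> (\<Sum>j\<in>UNIV. w $ i powr (1 - 2/p) * (w $ j powr (1 - 2/p) * (row j A \<bullet> y i)\<^sup>2))"
    by (intro sum_mono le)
  also have "\<dots> = w $ i powr (1 - 2/p) * (norm (B *v y i))\<^sup>2"
    by (simp add: norm_B_sq sum_distrib_left)
  also have "\<dots> = w $ i"
    using lewis_pos[of i] by (simp add: norm_B_y flip: powr_add)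
  finally show ?thesis .
qed

lemma lewis_le_sensitivity: "w $ i \<le> lp_sensitivity p A i"
proof -
  define L where "L = lp_norm p (A *v y i) powr p"
  have num: "\<bar>row i A \<bullet> y i\<bar> powr p = w $ i * w $ i"
    using lewis_pos[of i] p by (simp add: row_inner_y powr_powr power2_eq_square)
  \<comment> \<open>The positive numerator is itself a summand of \<open>L\<close>, which shows that
    the division by \<open>L\<close> is a genuine one.\<close>
  have "\<bar>row i A \<bullet> y i\<bar> powr p \<le> L"
    using p by (simp add: L_def lp_norm_powr flip: matrix_vector_mul_row)
      (rule member_le_sum; simp)
  then have L: "L > 0"
    using num lewis_pos[of i] by (smt (verit) mult_pos_pos)
  have "row i A \<bullet> y i \<noteq> 0"
    using lewis_pos[of i] by (simp add: row_inner_y)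
  then have y: "y i \<noteq> 0" by auto
  have "w $ i \<le> w $ i * w $ i / L"
    using L lp_norm_y_le[of i] lewis_pos[of i] by (simp add: L_def[symmetric] le_divide_eq)
  also have "\<dots> \<le> lp_sensitivity p A i"
    using quotient_le_lp_sensitivity[OF _ y, of p i A] p num by (simp add: L_def)
  finally show ?thesis .
qed

section \<open>Upper bound on the sensitivity\<close>

lemma norm_B_powr_le:
  "((norm (B *v x))\<^sup>2) powr (p/2) \<le> real CARD('n) powr (p/2 - 1) * lp_norm p (A *v x) powr p"
proof -
  \<comment> \<open>The exponent \<open>- 2/p\<close> serves two purposes:
    \<open>w $ j * u j\<close> is the summand of the quadratic form, and raising \<open>u j\<close>
    to \<open>p/2\<close> produces \<open>w $ j powr (-1)\<close>, which cancels the Jensen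
    weight.\<close>
  define u where "u j = w $ j powr (- 2/p) * (row j A \<bullet> x)\<^sup>2" for j
  have "w $ j powr (1 - 2/p) * (row j A \<bullet> x)\<^sup>2 = w $ j * u j" for j
    using lewis_pos[of j] by (simp add: u_def powr_diff powr_minus_divide)
  then have "(norm (B *v x))\<^sup>2 = (\<Sum>j\<in>UNIV. w $ j * u j)"
    by (simp add: norm_B_sq)
  moreover have "w $ j * u j powr (p/2) = \<bar>row j A \<bullet> x\<bar> powr p" for j
  proof -
    have "u j powr (p/2) = w $ j powr (-1) * \<bar>row j A \<bullet> x\<bar> powr p"
      using p by (simp add: u_def powr_mult powr_powr abs_powr_eq)
    then show ?thesis
      using lewis_pos[of j] by (simp add: powr_minus)
  qed
  moreover have "(\<Sum>j\<in>UNIV. w $ j * u j) powr (p/2)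
      \<le> (\<Sum>j\<in>UNIV. w $ j) powr (p/2 - 1) * (\<Sum>j\<in>UNIV. w $ j * u j powr (p/2))"
    using p lewis_pos by (intro sum_powr_jensen) (auto simp: u_def)
  ultimately show ?thesis
    using p by (simp add: sum_lewis lp_norm_powr matrix_vector_mul_row)
qed

lemma sensitivity_le_lewis:
  "lp_sensitivity p A i \<le> real CARD('n) powr (p/2 - 1) * w $ i"
proof (rule lp_sensitivity_le)
  fix x
  \<comment> \<open>Raising the Cauchy-Schwarz bound to the power \<open>p/2\<close> turns
    \<open>w $ i powr (2/p)\<close> into exactly \<open>w $ i\<close>.\<close>
  have "\<bar>row i A \<bullet> x\<bar> powr p \<le> (w $ i powr (2/p) * (norm (B *v x))\<^sup>2) powr (p/2)"
    unfolding abs_powr_eq using p by (intro powr_mono2 row_inner_sq_le) auto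
  also have "\<dots> = w $ i * ((norm (B *v x))\<^sup>2) powr (p/2)"
    using p lewis_pos[of i] by (simp add: powr_mult powr_powr)
  also have "\<dots> \<le> w $ i * (real CARD('n) powr (p/2 - 1) * lp_norm p (A *v x) powr p)"
    using lewis_pos[of i] by (intro mult_left_mono norm_B_powr_le) auto
  finally show "\<bar>row i A \<bullet> x\<bar> powr p
      \<le> real CARD('n) powr (p/2 - 1) * w $ i * lp_norm p (A *v x) powr p"
    by (simp add: mult_ac)
qed (simp add: lewis_pos less_imp_le)

end

theorem proposition1p6:
  fixes A :: "real ^ 'n ^ 'm" and p :: real and w :: "real ^ 'm"
  assumes full_column_rank: "rank A = CARD('n)"
    and no_zero_rows: "\<And>i. row i A \<noteq> 0"
    and p: "p > 2"
    and w: "is_lewis_weights p A w"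
  shows "(\<forall>i. w $ i \<le> lp_sensitivity p A i
            \<and> lp_sensitivity p A i \<le> real CARD('n) powr (p / 2 - 1) * w $ i)
       \<and> (\<forall>(\<epsilon>::real) (w' :: real ^ 'm).
            0 < \<epsilon> \<and> \<epsilon> < 1 \<and>
            (\<forall>i. (1 - \<epsilon>) * w $ i \<le> w' $ i \<and> w' $ i \<le> (1 + \<epsilon>) * w $ i) \<longrightarrow>
            (\<forall>i. w' $ i / (1 + \<epsilon>) \<le> lp_sensitivity p A i
               \<and> lp_sensitivity p A i \<le> real CARD('n) powr (p / 2 - 1) * w' $ i / (1 - \<epsilon>)))"
proof -
  have inj: "inj ((*v) A)"
    using full_column_rank by (simp add: full_rank_injective)
  have lower: "w $ i \<le> lp_sensitivity p A i" for i
    by (rule lewis_le_sensitivity[OF inj p w])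
  have upper: "lp_sensitivity p A i \<le> real CARD('n) powr (p / 2 - 1) * w $ i" for i
    by (rule sensitivity_le_lewis[OF inj p w])
  have "w' $ i / (1 + \<epsilon>) \<le> lp_sensitivity p A i
      \<and> lp_sensitivity p A i \<le> real CARD('n) powr (p / 2 - 1) * w' $ i / (1 - \<epsilon>)"
    if "0 < \<epsilon>" "\<epsilon> < 1" and w': "(1 - \<epsilon>) * w $ i \<le> w' $ i" "w' $ i \<le> (1 + \<epsilon>) * w $ i"
    for \<epsilon> :: real and w' :: "real ^ 'm" and i
  proof
    have "w' $ i / (1 + \<epsilon>) \<le> w $ i"
      using that by (simp add: divide_le_eq mult.commute)
    then show "w' $ i / (1 + \<epsilon>) \<le> lp_sensitivity p A i"
      using lower[of i] by linarith
    \<comment> \<open>The bound \<open>\<epsilon> < 1\<close> makes the divisor positive.\<close>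
    have "w $ i \<le> w' $ i / (1 - \<epsilon>)"
      using that by (simp add: le_divide_eq mult.commute)
    then have "real CARD('n) powr (p / 2 - 1) * w $ i
        \<le> real CARD('n) powr (p / 2 - 1) * (w' $ i / (1 - \<epsilon>))"
      by (intro mult_left_mono) auto
    then show "lp_sensitivity p A i \<le> real CARD('n) powr (p / 2 - 1) * w' $ i / (1 - \<epsilon>)"
      using upper[of i] by simp
  qed
  then show ?thesis
    using lower upper by blast
qed

end
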